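(* Consider a cache update system with $K=2$ caches and $N=2$ files, with source update rates $\lambda_1,\lambda_2>0$ and total rate budgets $C>0$, $U_1>0$, $U_2>0$. In an optimal policy, i.e. in any maximizer $(c_{ki},u_{ki})_{k,i\in\{1,2\}}$ of $F_u(1)+F_u(2)$ subject to $\sum_{k=1}^2\sum_{i=1}^2 c_{ki}\le C$, $u_{11}+u_{12}\le U_1$, $u_{21}+u_{22}\le U_2$ and $c_{ki},u_{ki}\ge 0$, at least one of the two files is restricted to a single route.
   Context: File $i$ is updated at the source at rate $\lambda_i$, the source updates file $i$ at cache $k$ at rate $c_{ki}$, and cache $k$ updates file $i$ at the user at rate $u_{ki}$, all inter-update times being independent exponentials. The freshness of file $i$ at the user (long-run fraction of time the user has the version currently at the source) is $$F_u(i)=\frac{(u_{1i}+u_{2i})(c_{1i}+c_{2i})}{(\lambda_i+u_{1i}+u_{2i})(\lambda_i+c_{1i}+c_{2i})}-\frac{\lambda_i}{(\lambda_i+u_{1i}+u_{2i})(\lambda_i+c_{1i}+c_{2i})}\left(\frac{u_{2i}c_{1i}}{\lambda_i+u_{1i}+c_{2i}}+\frac{u_{1i}c_{2i}}{\lambda_i+u_{2i}+c_{1i}}\right).$$ Route $k$ is the update path from the source through cache $k$ to the user. File $i$ is updated through route $k$ if both $c_{ki}>0$ and $u_{ki}>0$; file $i$ is restricted to a single route if it is not updated through both routes, i.e. $c_{ki}u_{ki}=0$ for at least one $k\in\{1,2\}$. *)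

theory Defs
  imports "HOL-Analysis.Analysis"
begin

text \<open>
  Caches \<open>k\<close> and files \<open>i\<close> are numbered 1, 2; values of the rate functions at other
  indices are irrelevant. \<open>lam i\<close> is the source update rate of file \<open>i\<close>, \<open>c k i\<close> the rate
  at which the source updates file \<open>i\<close> at cache \<open>k\<close>, and \<open>u k i\<close> the rate at which
  cache \<open>k\<close> updates file \<open>i\<close> at the user.
\<close>

text \<open>
  Long-run fraction of time the user holds the current version of file \<open>i\<close>, with two
  caches and all inter-update times independent and exponential, in closed form.
\<close>

definition freshness ::
  "(nat \<Rightarrow> real) \<Rightarrow> (nat \<Rightarrow> nat \<Rightarrow> real) \<Rightarrow> (nat \<Rightarrow> nat \<Rightarrow> real) \<Rightarrow> nat \<Rightarrow> real" where
  "freshness lam c u i =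
     ((u 1 i + u 2 i) * (c 1 i + c 2 i))
       / ((lam i + u 1 i + u 2 i) * (lam i + c 1 i + c 2 i))
     - lam i / ((lam i + u 1 i + u 2 i) * (lam i + c 1 i + c 2 i))
       * (u 2 i * c 1 i / (lam i + u 1 i + c 2 i) + u 1 i * c 2 i / (lam i + u 2 i + c 1 i))"

definition feasible_policy ::
  "real \<Rightarrow> (nat \<Rightarrow> real) \<Rightarrow> (nat \<Rightarrow> nat \<Rightarrow> real) \<Rightarrow> (nat \<Rightarrow> nat \<Rightarrow> real) \<Rightarrow> bool" where
  "feasible_policy C U c u \<longleftrightarrow>
     (\<forall>k\<in>{1..2}. \<forall>i\<in>{1..2}. 0 \<le> c k i \<and> 0 \<le> u k i)
     \<and> (\<Sum>k=1..2. \<Sum>i=1..2. c k i) \<le> C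
     \<and> (\<forall>k\<in>{1..2}. (\<Sum>i=1..2. u k i) \<le> U k)"

definition optimal_policy ::
  "(nat \<Rightarrow> real) \<Rightarrow> real \<Rightarrow> (nat \<Rightarrow> real) \<Rightarrow> (nat \<Rightarrow> nat \<Rightarrow> real) \<Rightarrow> (nat \<Rightarrow> nat \<Rightarrow> real) \<Rightarrow> bool" where
  "optimal_policy lam C U c u \<longleftrightarrow>
     feasible_policy C U c u
     \<and> (\<forall>c' u'. feasible_policy C U c' u' \<longrightarrow>
          (\<Sum>i=1..2. freshness lam c' u' i) \<le> (\<Sum>i=1..2. freshness lam c u i))"

definition updated_through ::
  "(nat \<Rightarrow> nat \<Rightarrow> real) \<Rightarrow> (nat \<Rightarrow> nat \<Rightarrow> real) \<Rightarrow> nat \<Rightarrow> nat \<Rightarrow> bool" where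
  "updated_through c u k i \<longleftrightarrow> c k i > 0 \<and> u k i > 0"

definition restricted_to_single_route ::
  "(nat \<Rightarrow> nat \<Rightarrow> real) \<Rightarrow> (nat \<Rightarrow> nat \<Rightarrow> real) \<Rightarrow> nat \<Rightarrow> bool" where
  "restricted_to_single_route c u i \<longleftrightarrow>
     \<not> (updated_through c u 1 i \<and> updated_through c u 2 i)"

end

theory Submission
  imports Defs
begin

text \<open>
  If both files used both routes, all eight rates would be positive, so a small rate \<open>e\<close> could be
  moved, for both \<open>c\<close> and \<open>u\<close>, from route 2 to route 1 for file 1 and from route 1 to route 2 for
  file 2, or in the opposite direction. Such a move preserves every budget. For each file it
  also preserves \<open>u 1 i + u 2 i\<close>, \<open>c 1 i + c 2 i\<close>, \<open>u 1 i + c 2 i\<close> and \<open>u 2 i + c 1 i\<close>, hence all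
  denominators of the freshness, which is thus a quadratic in \<open>e\<close> with positive leading coefficient.
  The total freshness is therefore strictly convex in \<open>e\<close> and cannot be maximal at \<open>e = 0\<close>.
\<close>

text \<open>The test \<open>k = i\<close> gives the shift matrix zero row and column sums, so each
  cache's total and each file's total survive. The sign of \<open>e\<close> covers both
  directions.\<close>

definition swap_rate :: "real \<Rightarrow> (nat \<Rightarrow> nat \<Rightarrow> real) \<Rightarrow> nat \<Rightarrow> nat \<Rightarrow> real" where
  "swap_rate e v k i = (if k = i then v k i + e else v k i - e)"

text \<open>With \<open>P\<close> and \<open>Q\<close> fixed, the terms linear in \<open>e\<close>
  cancel between the two opposite shifts; each product contributes only
  \<open>- e\<^sup>2\<close>.\<close>

lemma cross_loss_strictly_concave:
  fixes a b x y e P Q :: real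
  assumes "P > 0" "Q > 0" "e \<noteq> 0"
  shows "((b - e) * (x + e) / P + (a + e) * (y - e) / Q)
       + ((b + e) * (x - e) / P + (a - e) * (y + e) / Q) < 2 * (b * x / P + a * y / Q)"
proof -
  have "((b - e) * (x + e) / P + (a + e) * (y - e) / Q)
       + ((b + e) * (x - e) / P + (a - e) * (y + e) / Q)
       = 2 * (b * x / P + a * y / Q) - 2 * (e\<^sup>2 / P + e\<^sup>2 / Q)"
    using assms by (simp add: field_simps power2_eq_square)
  moreover have "e\<^sup>2 / P + e\<^sup>2 / Q > 0"
    using assms by (simp add: add_pos_pos)
  moreover have "v < r" if "v = r - 2 * t" "t > 0" for v r t :: real
    using that by simp
  ultimately show ?thesis by blast
qed

text \<open>Along the swap only the subtracted cross term \<open>L\<close> varies; its weight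
  \<open>- w\<close> is a negative constant and turns strict concavity into strict
  convexity.\<close>

lemma freshness_swap_strictly_convex:
  assumes i: "i \<in> {1..2}" and lam: "lam i > 0" and e: "e \<noteq> 0"
    and pos: "\<And>k. k \<in> {1..2} \<Longrightarrow> c k i > 0 \<and> u k i > 0"
  shows "2 * freshness lam c u i
       < freshness lam (swap_rate e c) (swap_rate e u) i
         + freshness lam (swap_rate (- e) c) (swap_rate (- e) u) i"
proof -
  define a b x y where defs: "a = u 1 i" "b = u 2 i" "x = c 1 i" "y = c 2 i"
  have p: "a > 0" "b > 0" "x > 0" "y > 0"
    using pos[of 1] pos[of 2] by (auto simp: defs)
  define P Q where PQ: "P = lam i + a + y" "Q = lam i + b + x"
  define A where A: "A = ((a + b) * (x + y)) / ((lam i + a + b) * (lam i + x + y))"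
  define w where w: "w = lam i / ((lam i + a + b) * (lam i + x + y))"
  define L where L: "L d = (b - d) * (x + d) / P + (a + d) * (y - d) / Q" for d
  \<comment> \<open>A swap by \<open>d\<close> raises route 1 for file 1 but lowers it for file 2;
    the sign \<open>s\<close> lets one formula serve both files.\<close>
  define s where s: "s = (if i = 1 then 1 else - 1 :: real)"
  have fresh: "freshness lam (swap_rate d c) (swap_rate d u) i = A - w * L (s * d)" for d
  proof -
    have rates: "swap_rate d u 1 i = a + s * d" "swap_rate d u 2 i = b - s * d"
         "swap_rate d c 1 i = x + s * d" "swap_rate d c 2 i = y - s * d"
      using i by (auto simp: swap_rate_def s defs)
    have "a + s * d + (b - s * d) = a + b" "x + s * d + (y - s * d) = x + y"
      "lam i + (a + s * d) + (b - s * d) = lam i + a + b"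
      "lam i + (x + s * d) + (y - s * d) = lam i + x + y"
      "lam i + (a + s * d) + (y - s * d) = P" "lam i + (b - s * d) + (x + s * d) = Q"
      by (simp_all add: PQ)
    then show ?thesis
      unfolding freshness_def rates A w L by (simp only:)
  qed
  have "L (s * e) + L (s * - e) < 2 * L 0"
    using cross_loss_strictly_concave[of P Q "s * e" b x a y] p lam e
    by (simp add: L PQ s)
  moreover have "w > 0"
    using p lam by (simp add: w)
  ultimately have "w * (L (s * e) + L (s * - e)) < w * (2 * L 0)"
    by (rule mult_strict_left_mono)
  moreover have "freshness lam c u i = A - w * L 0"
  proof -
    have "swap_rate 0 v = v" for v
      by (simp add: swap_rate_def fun_eq_iff)
    then show ?thesis
      using fresh[of 0] by simp
  qed
  ultimately show ?thesis
    unfolding fresh by (simp add: algebra_simps)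
qed

lemma feasible_policy_swap:
  assumes feas: "feasible_policy C U c u"
    and le: "\<And>k i. k \<in> {1..2} \<Longrightarrow> i \<in> {1..2} \<Longrightarrow> \<bar>e\<bar> \<le> c k i \<and> \<bar>e\<bar> \<le> u k i"
  shows "feasible_policy C U (swap_rate e c) (swap_rate e u)"
proof -
  have two: "{1..2} = {1, 2 :: nat}" by auto
  have "0 \<le> swap_rate e c k i \<and> 0 \<le> swap_rate e u k i" if "k \<in> {1..2}" "i \<in> {1..2}" for k i
    using le[OF that] by (auto simp: swap_rate_def)
  then have "\<forall>k\<in>{1..2}. \<forall>i\<in>{1..2}. 0 \<le> swap_rate e c k i \<and> 0 \<le> swap_rate e u k i"
    by blast
  moreover have "(\<Sum>k=1..2. \<Sum>i=1..2. swap_rate e c k i) = (\<Sum>k=1..2. \<Sum>i=1..2. c k i)"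
    and "\<forall>k\<in>{1..2}. (\<Sum>i=1..2. swap_rate e u k i) = (\<Sum>i=1..2. u k i)"
    unfolding two by (auto simp: swap_rate_def)
  ultimately show ?thesis
    using feas unfolding feasible_policy_def by metis
qed

theorem lemma3:
  fixes lam U :: "nat \<Rightarrow> real"
    and C :: real
    and c u :: "nat \<Rightarrow> nat \<Rightarrow> real"
  assumes "lam 1 > 0" and "lam 2 > 0"
    and "C > 0" and "U 1 > 0" and "U 2 > 0"
    and "optimal_policy lam C U c u"
  shows "\<exists>i\<in>{1..2}. restricted_to_single_route c u i"
proof (rule ccontr)
  assume neg: "\<not> ?thesis"
  have two: "{1..2} = {1, 2 :: nat}" by auto
  have pos: "c k i > 0 \<and> u k i > 0" if "k \<in> {1..2}" "i \<in> {1..2}" for k i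
    using neg that unfolding two by (auto simp: restricted_to_single_route_def updated_through_def)
  \<comment> \<open>The least of the eight rates is positive, and shifting by it in either direction
    leaves every rate nonnegative.\<close>
  define V where "V = (\<lambda>(k, i). min (c k i) (u k i)) ` ({1..2} \<times> {1..2})"
  define e where "e = Min V"
  have "finite V" "V \<noteq> {}" by (auto simp: V_def)
  then have e_pos: "e > 0"
    using pos by (auto simp: e_def V_def)
  have e_le: "e \<le> c k i \<and> e \<le> u k i" if "k \<in> {1..2}" "i \<in> {1..2}" for k i
  proof -
    have "min (c k i) (u k i) \<in> V" using that by (force simp: V_def)
    then have "e \<le> min (c k i) (u k i)"
      unfolding e_def using \<open>finite V\<close> by (rule Min_le[rotated])
    then show ?thesis by simp
  qed
  let ?S = "\<lambda>d. \<Sum>i=1..2. freshness lam (swap_rate d c) (swap_rate d u) i"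
  have feas: "feasible_policy C U c u"
    and opt: "\<And>c' u'. feasible_policy C U c' u' \<Longrightarrow>
      (\<Sum>i=1..2. freshness lam c' u' i) \<le> (\<Sum>i=1..2. freshness lam c u i)"
    using assms(6) by (auto simp: optimal_policy_def)
  have "?S d \<le> (\<Sum>i=1..2. freshness lam c u i)" if "\<bar>d\<bar> = e" for d
    using e_le that by (intro opt feasible_policy_swap[OF feas]) auto
  \<comment> \<open>Adding the optimality bounds for the two opposite swaps avoids derivatives:
    strict convexity, summed over the files, gives the reverse strict inequality.\<close>
  from this[of e] this[of "- e"]
  have "?S e + ?S (- e) \<le> 2 * (\<Sum>i=1..2. freshness lam c u i)"
    using e_pos by simp
  moreover have "2 * freshness lam c u i
      < freshness lam (swap_rate e c) (swap_rate e u) i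
        + freshness lam (swap_rate (- e) c) (swap_rate (- e) u) i" if "i \<in> {1..2}" for i
  proof (rule freshness_swap_strictly_convex)
    show "lam i > 0"
      using that assms(1,2) unfolding two by auto
  qed (use that pos e_pos in auto)
  from this[of 1] this[of 2]
  have "2 * (\<Sum>i=1..2. freshness lam c u i) < ?S e + ?S (- e)"
    unfolding two by simp
  ultimately show False by simp
qed

end
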